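(* Let $h\in\mathbb{R}[x_1,\dots,x_n]$ be a homogeneous polynomial that is hyperbolic with respect to $e\in\mathbb{R}^n$. Then for all $a\in C(h,e)$ with $D_eh(a)\neq0$ the polynomial $$\Delta_{e,a}(h)-\frac{h(a)}{D_eh(a)}\cdot(D_eh)^2$$ is nonnegative on all of $\mathbb{R}^n$.
   Context: For $v\in\mathbb{R}^n$, $D_v=\sum_{i=1}^n v_i\frac{\partial}{\partial x_i}$. For $a,b\in\mathbb{R}^n$ and $h\in\mathbb{R}[x_1,\dots,x_n]$, the Wronskian polynomial is $\Delta_{a,b}(h)=D_ah\cdot D_bh-h\cdot D_aD_bh$. A homogeneous polynomial $h$ is hyperbolic with respect to $e$ if $h(e)>0$ and for all $a\in\mathbb{R}^n$ the polynomial $h(te-a)\in\mathbb{R}[t]$ has only real roots; its hyperbolicity cone $C(h,e)$ is the set of all $a\in\mathbb{R}^n$ such that all zeros of $h(te-a)$ are nonnegative. *)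

theory Defs
  imports "HOL-Analysis.Analysis" "HOL-Library.Poly_Mapping"
    "HOL-Computational_Algebra.Polynomial"
begin

text \<open>
  Polynomials over the reals in finitely many variables indexed by \<open>'n\<close>: an exponent vector is
  a finitely supported map \<open>'n \<Rightarrow>\<^sub>0 nat\<close>, and the ring structure (convolution product)
  is the one provided by the theory of finitely supported maps.
\<close>

type_synonym 'n real_mpoly = "('n \<Rightarrow>\<^sub>0 nat) \<Rightarrow>\<^sub>0 real"

definition mconst :: "real \<Rightarrow> 'n real_mpoly" where
  "mconst c = Poly_Mapping.single 0 c"

definition meval :: "('n::finite) real_mpoly \<Rightarrow> real ^ 'n \<Rightarrow> real" where
  "meval h x = (\<Sum>m\<in>Poly_Mapping.keys h.
     Poly_Mapping.lookup h m * (\<Prod>i\<in>UNIV. x $ i ^ Poly_Mapping.lookup m i))"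

text \<open>
  In \<open>mpartial\<close> the subtraction of exponents is truncated, which is harmless: it only matters when
  the exponent of \<open>i\<close> is \<open>0\<close>, and then the coefficient is \<open>0\<close>.
\<close>

definition mpartial :: "'n \<Rightarrow> 'n real_mpoly \<Rightarrow> 'n real_mpoly" where
  "mpartial i h = (\<Sum>m\<in>Poly_Mapping.keys h.
     Poly_Mapping.single (m - Poly_Mapping.single i 1)
       (real (Poly_Mapping.lookup m i) * Poly_Mapping.lookup h m))"

definition dir_deriv :: "real ^ 'n \<Rightarrow> ('n::finite) real_mpoly \<Rightarrow> 'n real_mpoly" where
  "dir_deriv v h = (\<Sum>i\<in>UNIV. mconst (v $ i) * mpartial i h)"

definition wronskian ::
    "real ^ 'n \<Rightarrow> real ^ 'n \<Rightarrow> ('n::finite) real_mpoly \<Rightarrow> 'n real_mpoly" where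
  "wronskian a b h = dir_deriv a h * dir_deriv b h - h * dir_deriv a (dir_deriv b h)"

definition mhomogeneous :: "('n::finite) real_mpoly \<Rightarrow> bool" where
  "mhomogeneous h \<longleftrightarrow>
     (\<exists>d. \<forall>m\<in>Poly_Mapping.keys h. (\<Sum>i\<in>UNIV. Poly_Mapping.lookup m i) = d)"

text \<open>The univariate polynomial \<open>h(t e - a)\<close> in \<open>t\<close>.\<close>

definition line_poly ::
    "('n::finite) real_mpoly \<Rightarrow> real ^ 'n \<Rightarrow> real ^ 'n \<Rightarrow> real poly" where
  "line_poly h e a = (\<Sum>m\<in>Poly_Mapping.keys h.
     smult (Poly_Mapping.lookup h m)
       (\<Prod>i\<in>UNIV. [:- (a $ i), e $ i:] ^ Poly_Mapping.lookup m i))"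

lemma poly_line_poly: "poly (line_poly h e a) t = meval h (t *\<^sub>R e - a)"
  by (simp add: line_poly_def meval_def poly_sum poly_prod algebra_simps)

definition hyperbolic :: "('n::finite) real_mpoly \<Rightarrow> real ^ 'n \<Rightarrow> bool" where
  "hyperbolic h e \<longleftrightarrow> mhomogeneous h \<and> meval h e > 0 \<and>
     (\<forall>a. \<forall>z::complex.
        poly (map_poly complex_of_real (line_poly h e a)) z = 0 \<longrightarrow> z \<in> \<real>)"

text \<open>
  The cone is only used for hyperbolic \<open>h\<close>, where every complex zero is real, so that
  quantifying over real zeros covers all zeros.
\<close>

definition hyperbolicity_cone ::
    "('n::finite) real_mpoly \<Rightarrow> real ^ 'n \<Rightarrow> (real ^ 'n) set" where
  "hyperbolicity_cone h e = {a. \<forall>t::real. poly (line_poly h e a) t = 0 \<longrightarrow> 0 \<le> t}"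

end

theory Submission
  imports Defs "HOL-Computational_Algebra.Fundamental_Theorem_Algebra"
begin

text \<open>
  The assertion says that the derivative of \<open>h / D\<^sub>e h\<close> in direction \<open>a\<close> is at least its value at \<open>a\<close>.
  Assume first that \<open>h(a) \<noteq> 0\<close>. For \<open>\<rho> > 0\<close> the polynomial \<open>s \<mapsto> h(x + s a + \<i> \<rho> e)\<close> factors as
  \<open>h(a) \<Prod> (s - z\<^sub>j)\<close> with all \<open>z\<^sub>j\<close> in the open lower half plane, and comparing linear terms gives
  \<open>\<Sum> - Im z\<^sub>j = \<rho> D\<^sub>e h(a) / h(a)\<close>. The elementary bound
  \<open>\<bar>Im \<Prod> w\<^sub>j\<bar> \<le> \<Prod> \<bar>w\<^sub>j\<bar> \<cdot> \<Sum> \<bar>Im w\<^sub>j\<bar> / \<bar>w\<^sub>j\<bar>\<close> and the Cauchy-Schwarz inequality then bound the square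
  of \<open>Im h(x + \<i> \<rho> e)\<close>; dividing by \<open>\<rho>\<^sup>2\<close> and letting \<open>\<rho> \<rightarrow> 0\<close> yields the claim. If \<open>h(a) = 0\<close>, replace
  \<open>a\<close> by \<open>a + \<epsilon> e\<close> and let \<open>\<epsilon> \<rightarrow> 0\<close>.
\<close>

section \<open>Complex evaluation\<close>

definition mono_eval :: "('n::finite \<Rightarrow>\<^sub>0 nat) \<Rightarrow> complex ^ 'n \<Rightarrow> complex" where
  "mono_eval m v = (\<Prod>i\<in>UNIV. v $ i ^ Poly_Mapping.lookup m i)"

text \<open>Complex points are required because the argument runs through
  \<open>x + \<i> \<rho> e\<close>. Identities for \<open>meval\<close> are read off from those for
  \<open>ceval\<close> through \<open>ceval_cvec\<close>, since the embedding of the reals is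
  injective.\<close>

definition ceval :: "('n::finite) real_mpoly \<Rightarrow> complex ^ 'n \<Rightarrow> complex" where
  "ceval h v = (\<Sum>m\<in>Poly_Mapping.keys h. of_real (Poly_Mapping.lookup h m) * mono_eval m v)"

definition cvec :: "real ^ 'n \<Rightarrow> complex ^ 'n" where
  "cvec x = (\<chi> i. complex_of_real (x $ i))"

lemma cvec_nth [simp]: "cvec x $ i = complex_of_real (x $ i)"
  by (simp add: cvec_def)

lemma ceval_cvec: "ceval h (cvec x) = complex_of_real (meval h x)"
  by (simp add: ceval_def meval_def mono_eval_def)

lemma mono_eval_add: "mono_eval (m + n) v = mono_eval m v * mono_eval n v"
  by (simp add: mono_eval_def lookup_add power_add prod.distrib)

lemma ceval_zero [simp]: "ceval 0 v = 0"
  by (simp add: ceval_def)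

lemma ceval_add: "ceval (p + q) v = ceval p v + ceval q v"
  unfolding ceval_def by (rule setsum_keys_plus_distrib) (auto simp: algebra_simps)

lemma ceval_uminus: "ceval (- p) v = - ceval p v"
  by (simp add: ceval_def sum_negf)

lemma ceval_diff: "ceval (p - q) v = ceval p v - ceval q v"
  using ceval_add[of p "- q" v] by (simp add: ceval_uminus)

lemma ceval_sum: "ceval (sum f A) v = (\<Sum>i\<in>A. ceval (f i) v)"
  by (induction A rule: infinite_finite_induct) (auto simp: ceval_add)

lemma ceval_single: "ceval (Poly_Mapping.single m c) v = of_real c * mono_eval m v"
  by (cases "c = 0") (auto simp: ceval_def)

lemma mpoly_eq_sum_single:
  fixes h :: "'n real_mpoly"
  shows "h = (\<Sum>m\<in>Poly_Mapping.keys h. Poly_Mapping.single m (Poly_Mapping.lookup h m))"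
proof (rule poly_mapping_eqI)
  fix k
  have "Poly_Mapping.lookup (\<Sum>m\<in>Poly_Mapping.keys h. Poly_Mapping.single m (Poly_Mapping.lookup h m)) k
      = (\<Sum>m\<in>Poly_Mapping.keys h. if m = k then Poly_Mapping.lookup h k else 0)"
    by (auto simp: lookup_sum lookup_single when_def intro!: sum.cong)
  then show "Poly_Mapping.lookup h k = Poly_Mapping.lookup
      (\<Sum>m\<in>Poly_Mapping.keys h. Poly_Mapping.single m (Poly_Mapping.lookup h m)) k"
    by (simp add: in_keys_iff)
qed

lemma ceval_mult: "ceval (p * q) v = ceval p v * ceval q v"
proof -
  let ?c = "Poly_Mapping.lookup" and ?k = "Poly_Mapping.keys"
  have "p * q = (\<Sum>m\<in>?k p. \<Sum>n\<in>?k q. Poly_Mapping.single (m + n) (?c p m * ?c q n))"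
    by (subst mpoly_eq_sum_single[of p], subst mpoly_eq_sum_single[of q])
       (simp add: sum_distrib_left sum_distrib_right mult_single sum.swap[of _ "?k q"])
  then have "ceval (p * q) v = (\<Sum>m\<in>?k p. \<Sum>n\<in>?k q.
      (of_real (?c p m) * mono_eval m v) * (of_real (?c q n) * mono_eval n v))"
    by (simp add: ceval_sum ceval_single mono_eval_add mult_ac)
  then show ?thesis
    by (simp add: ceval_def sum_product)
qed

lemma ceval_mconst: "ceval (mconst c) v = of_real c"
  by (simp add: mconst_def ceval_single mono_eval_def)

lemma meval_diff: "meval (p - q) x = meval p x - meval q x"
  and meval_mult: "meval (p * q) x = meval p x * meval q x"
  and meval_mconst: "meval (mconst c) x = c"
  using ceval_diff[of p q "cvec x"] ceval_mult[of p q "cvec x"] ceval_mconst[of c "cvec x"]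
  by (simp_all add: ceval_cvec flip: of_real_diff of_real_mult)

lemma continuous_on_ceval [continuous_intros]:
  "continuous_on S f \<Longrightarrow> continuous_on S (\<lambda>x. ceval h (f x))"
  unfolding ceval_def mono_eval_def by (intro continuous_intros)

section \<open>Formal partial derivatives as derivatives along complex lines\<close>

lemma ceval_mpartial:
  "ceval (mpartial i h) v = (\<Sum>m\<in>Poly_Mapping.keys h. of_real (Poly_Mapping.lookup h m) *
     (of_nat (Poly_Mapping.lookup m i) * mono_eval (m - Poly_Mapping.single i 1) v))"
  by (simp add: mpartial_def ceval_sum ceval_single mult_ac)

lemma ceval_dir_deriv:
  "ceval (dir_deriv d h) v = (\<Sum>i\<in>UNIV. of_real (d $ i) * ceval (mpartial i h) v)"
  by (simp add: dir_deriv_def ceval_sum ceval_mult ceval_mconst)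

lemma meval_dir_deriv: "meval (dir_deriv d h) x = (\<Sum>i\<in>UNIV. d $ i * meval (mpartial i h) x)"
proof -
  have "complex_of_real (meval (dir_deriv d h) x) = of_real (\<Sum>i\<in>UNIV. d $ i * meval (mpartial i h) x)"
    using ceval_dir_deriv[of d h "cvec x"] by (simp add: ceval_cvec)
  then show ?thesis
    by (simp only: of_real_eq_iff)
qed

text \<open>Splits off the factor of the variable \<open>i\<close>, the form in which the product
  rule delivers the derivative of a monomial. Both sides truncate the exponent in the same way, so
  exponent 0 is covered.\<close>

lemma mono_eval_minus_single:
  "mono_eval (m - Poly_Mapping.single i 1) v =
     v $ i ^ (Poly_Mapping.lookup m i - 1) * (\<Prod>j\<in>UNIV - {i}. v $ j ^ Poly_Mapping.lookup m j)"
  by (simp add: mono_eval_def prod.remove[of UNIV i] lookup_minus lookup_single)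

text \<open>Product rule on each monomial. The direction \<open>v\<close> may be complex, so that
  derivatives in the direction \<open>x + \<i> \<rho> e\<close> are available later.\<close>

lemma DERIV_ceval_line:
  "((\<lambda>s. ceval h (u + s *s v)) has_field_derivative
     (\<Sum>i\<in>UNIV. v $ i * ceval (mpartial i h) (u + s *s v))) (at s)"
proof -
  have mono: "((\<lambda>s. mono_eval m (u + s *s v)) has_field_derivative
      (\<Sum>i\<in>UNIV. v $ i * (of_nat (Poly_Mapping.lookup m i) *
         mono_eval (m - Poly_Mapping.single i 1) (u + s *s v)))) (at s)" for m
    unfolding mono_eval_minus_single unfolding mono_eval_def
    by (rule DERIV_cong, rule has_field_derivative_prod)
       (auto intro!: derivative_eq_intros sum.cong)
  show ?thesis
    unfolding ceval_def[of h] ceval_mpartial sum_distrib_left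
    by (subst sum.swap) (auto intro!: derivative_eq_intros mono sum.cong simp: sum_distrib_left mult_ac)
qed

lemma DERIV_ceval_dir:
  "((\<lambda>s. ceval h (u + s *s cvec d)) has_field_derivative
     ceval (dir_deriv d h) (u + s *s cvec d)) (at s)"
  using DERIV_ceval_line[of h u "cvec d" s] by (simp add: ceval_dir_deriv)

section \<open>Restriction of a homogeneous polynomial to a line and its linear factors\<close>

lemma hyperbolic_degree:
  assumes "hyperbolic h e"
  shows "\<exists>d. \<forall>m\<in>Poly_Mapping.keys h. (\<Sum>i\<in>UNIV. Poly_Mapping.lookup m i) = d"
  using assms by (simp add: hyperbolic_def mhomogeneous_def)

text \<open>A factor \<open>[:b, c:]\<close> may have \<open>c = 0\<close>, so degrees are only
  bounded and the coefficient at the nominal degree is tracked. In the convolution every index other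
  than \<open>k\<close> exceeds one of the two bounds.\<close>

lemma coeff_mult_of_degree_le:
  fixes p q :: "'a::comm_semiring_0 poly"
  assumes "degree p \<le> k" "degree q \<le> l"
  shows "degree (p * q) \<le> k + l \<and> coeff (p * q) (k + l) = coeff p k * coeff q l"
proof
  show "degree (p * q) \<le> k + l"
    using degree_mult_le[of p q] assms by linarith
  have "coeff (p * q) (k + l) = (\<Sum>i\<le>k + l. coeff p i * coeff q (k + l - i))"
    by (simp add: coeff_mult)
  also have "\<dots> = (\<Sum>i\<in>{k}. coeff p i * coeff q (k + l - i))"
  proof (rule sum.mono_neutral_right)
    show "\<forall>i\<in>{..k + l} - {k}. coeff p i * coeff q (k + l - i) = 0"
    proof
      fix i assume "i \<in> {..k + l} - {k}"
      then have "i < k \<or> k < i" by auto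
      then show "coeff p i * coeff q (k + l - i) = 0"
        using assms by (auto simp: coeff_eq_0)
    qed
  qed auto
  finally show "coeff (p * q) (k + l) = coeff p k * coeff q l" by simp
qed

lemma coeff_power_of_linear:
  fixes b c :: "'a::comm_semiring_1"
  shows "degree ([:b, c:] ^ k) \<le> k \<and> coeff ([:b, c:] ^ k) k = c ^ k"
proof (induction k)
  case (Suc k)
  have "degree [:b, c:] \<le> 1" by simp
  from coeff_mult_of_degree_le[OF this Suc[THEN conjunct1]] Suc show ?case by simp
qed simp

lemma coeff_prod_of_linear_powers:
  fixes b c :: "'i \<Rightarrow> 'a::comm_semiring_1"
  assumes "finite A"
  shows "degree (\<Prod>i\<in>A. [:b i, c i:] ^ k i) \<le> (\<Sum>i\<in>A. k i) \<and>
    coeff (\<Prod>i\<in>A. [:b i, c i:] ^ k i) (\<Sum>i\<in>A. k i) = (\<Prod>i\<in>A. c i ^ k i)"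
  using assms
proof (induction A)
  case (insert i A)
  from coeff_mult_of_degree_le[OF coeff_power_of_linear[THEN conjunct1] insert.IH[THEN conjunct1]]
  show ?case using insert by (simp add: coeff_power_of_linear)
qed simp

definition complex_line_poly ::
    "('n::finite) real_mpoly \<Rightarrow> complex ^ 'n \<Rightarrow> complex ^ 'n \<Rightarrow> complex poly" where
  "complex_line_poly h u v = (\<Sum>m\<in>Poly_Mapping.keys h.
     smult (of_real (Poly_Mapping.lookup h m))
       (\<Prod>i\<in>UNIV. [:u $ i, v $ i:] ^ Poly_Mapping.lookup m i))"

lemma poly_complex_line_poly: "poly (complex_line_poly h u v) s = ceval h (u + s *s v)"
  by (simp add: complex_line_poly_def ceval_def mono_eval_def poly_sum poly_prod)

text \<open>By homogeneity the coefficient of \<open>s ^ d\<close> in the restriction to the line is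
  \<open>ceval h v\<close>. As it is nonzero, the degree is exactly \<open>d\<close>, and the
  fundamental theorem of algebra supplies \<open>d\<close> roots with multiplicity.\<close>

lemma ceval_line_factor:
  assumes hom: "\<And>m. m \<in> Poly_Mapping.keys h \<Longrightarrow> (\<Sum>i\<in>UNIV. Poly_Mapping.lookup m i) = d"
    and nz: "ceval h v \<noteq> 0"
  obtains z where "\<And>s. ceval h (u + s *s v) = ceval h v * (\<Prod>j<d. s - z j)"
proof -
  define q where "q m = (\<Prod>i\<in>UNIV. [:u $ i, v $ i:] ^ Poly_Mapping.lookup m i)" for m
  define P where "P = complex_line_poly h u v"
  have P_eq: "P = (\<Sum>m\<in>Poly_Mapping.keys h. smult (of_real (Poly_Mapping.lookup h m)) (q m))"
    by (simp add: P_def complex_line_poly_def q_def)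
  have q: "degree (q m) \<le> d \<and> coeff (q m) d = mono_eval m v" if "m \<in> Poly_Mapping.keys h" for m
    using coeff_prod_of_linear_powers[of UNIV "\<lambda>i. u $ i" "\<lambda>i. v $ i" "Poly_Mapping.lookup m"] hom[OF that]
    by (simp add: q_def mono_eval_def)
  have "degree P \<le> d"
    unfolding P_eq by (intro degree_sum_le order.trans[OF degree_smult_le]) (auto simp: q)
  moreover have "coeff P d = ceval h v"
    by (simp add: P_eq coeff_sum q ceval_def)
  ultimately have P: "degree P = d" "coeff P d = ceval h v"
    using nz le_degree[of P d] by auto
  obtain z where z: "smult (lead_coeff P) (\<Prod>i<degree P. [:- z i, 1:]) = P"
    by (rule complex_poly_decompose')
  have "poly P s = ceval h v * (\<Prod>j<d. s - z j)" for s
    by (subst z[symmetric]) (simp only: P poly_smult poly_prod, simp)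
  then show thesis
    using that unfolding P_def poly_complex_line_poly by metis
qed

lemma ceval_scale:
  assumes hom: "\<And>m. m \<in> Poly_Mapping.keys h \<Longrightarrow> (\<Sum>i\<in>UNIV. Poly_Mapping.lookup m i) = d"
  shows "ceval h (c *s v) = c ^ d * ceval h v"
proof -
  have "mono_eval m (c *s v) = c ^ d * mono_eval m v" if "m \<in> Poly_Mapping.keys h" for m
    by (simp add: mono_eval_def power_mult_distrib prod.distrib power_sum flip: hom[OF that])
  then show ?thesis
    by (simp add: ceval_def sum_distrib_left mult_ac)
qed

lemma poly_map_poly_of_real:
  "poly (map_poly complex_of_real p) (complex_of_real t) = complex_of_real (poly p t)"
  by (induction p) (auto simp: map_poly_pCons)

text \<open>Both sides are polynomials in \<open>z\<close> that agree at all real points, hence at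
  infinitely many.\<close>

lemma poly_complexified_line_poly:
  "poly (map_poly complex_of_real (line_poly h e a)) z = ceval h (z *s cvec e - cvec a)"
proof -
  let ?P = "map_poly complex_of_real (line_poly h e a)"
  let ?Q = "complex_line_poly h (- cvec a) (cvec e)"
  have "poly (?P - ?Q) (complex_of_real t) = 0" for t
  proof -
    have "poly ?P (complex_of_real t) = complex_of_real (meval h (t *\<^sub>R e - a))"
      by (simp add: poly_map_poly_of_real poly_line_poly)
    also have "\<dots> = ceval h (cvec (t *\<^sub>R e - a))"
      by (simp add: ceval_cvec)
    also have "cvec (t *\<^sub>R e - a) = - cvec a + complex_of_real t *s cvec e"
      by (simp add: vec_eq_iff)
    finally show ?thesis
      by (simp add: poly_complex_line_poly)
  qed
  then have "range complex_of_real \<subseteq> {t. poly (?P - ?Q) t = 0}"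
    by blast
  moreover have "infinite (range complex_of_real)"
    by (simp add: finite_image_iff infinite_UNIV_char_0 inj_of_real)
  ultimately have "infinite {t. poly (?P - ?Q) t = 0}"
    using finite_subset by blast
  then have "?P - ?Q = 0"
    using poly_roots_finite by blast
  then have "?P = ?Q"
    by simp
  then show ?thesis
    by (simp add: poly_complex_line_poly)
qed

section \<open>Zeros along directions of the hyperbolicity cone\<close>

text \<open>Induction with Im(wP) = Re w Im P + Im w Re P, where the real parts are bounded by the
  moduli.\<close>

lemma abs_Im_prod_le:
  assumes "finite I" "\<And>i. i \<in> I \<Longrightarrow> w i \<noteq> 0"
  shows "\<bar>Im (\<Prod>i\<in>I. w i)\<bar> \<le> norm (\<Prod>i\<in>I. w i) * (\<Sum>i\<in>I. \<bar>Im (w i)\<bar> / norm (w i))"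
  using assms
proof (induction I)
  case (insert j I)
  let ?P = "\<Prod>i\<in>I. w i" and ?S = "\<Sum>i\<in>I. \<bar>Im (w i)\<bar> / norm (w i)"
  have "\<bar>Im (w j * ?P)\<bar> \<le> \<bar>Re (w j)\<bar> * \<bar>Im ?P\<bar> + \<bar>Im (w j)\<bar> * \<bar>Re ?P\<bar>"
    by (simp add: flip: abs_mult)
  also have "\<dots> \<le> norm (w j) * (norm ?P * ?S) + \<bar>Im (w j)\<bar> * norm ?P"
    using insert by (intro add_mono mult_mono abs_Re_le_cmod) auto
  also have "\<dots> = norm (w j * ?P) * (\<bar>Im (w j)\<bar> / norm (w j) + ?S)"
    using insert.prems[of j] by (simp add: norm_mult field_simps)
  finally show ?case using insert by simp
qed simp

lemma lower_half_plane_prod_ineq: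
  fixes z :: "nat \<Rightarrow> complex"
  assumes "\<And>j. j < d \<Longrightarrow> Im (z j) < 0"
  shows "(Im (\<Prod>j<d. - z j))\<^sup>2 \<le> (norm (\<Prod>j<d. - z j))\<^sup>2 *
    ((\<Sum>j<d. - Im (z j) / (norm (z j))\<^sup>2) * (\<Sum>j<d. - Im (z j)))"
proof -
  let ?P = "\<Prod>j<d. - z j" and ?S = "\<Sum>j<d. - Im (z j) / norm (z j)"
  have nz: "z j \<noteq> 0" if "j < d" for j
    using assms[OF that] by auto
  have "\<bar>Im ?P\<bar> \<le> norm ?P * (\<Sum>j<d. \<bar>Im (- z j)\<bar> / norm (- z j))"
    by (rule abs_Im_prod_le) (auto simp: nz)
  also have "(\<Sum>j<d. \<bar>Im (- z j)\<bar> / norm (- z j)) = ?S"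
    using assms by (intro sum.cong) (auto simp: abs_of_neg)
  finally have "\<bar>Im ?P\<bar>\<^sup>2 \<le> (norm ?P * ?S)\<^sup>2"
    by (intro power_mono) auto
  then have "(Im ?P)\<^sup>2 \<le> (norm ?P)\<^sup>2 * ?S\<^sup>2"
    by (simp add: power_mult_distrib)
  \<comment> \<open>This splitting makes the two Cauchy-Schwarz factors the sums of -Im z / |z|^2
    and of -Im z; the square roots are harmless because every -Im z is positive.\<close>
  moreover have "?S = (\<Sum>j<d. (sqrt (- Im (z j)) / norm (z j)) * sqrt (- Im (z j)))"
    using assms by (intro sum.cong) (auto simp: less_imp_le)
  moreover have "(\<Sum>j<d. (sqrt (- Im (z j)) / norm (z j)) * sqrt (- Im (z j)))\<^sup>2 \<le>
      (\<Sum>j<d. (sqrt (- Im (z j)) / norm (z j))\<^sup>2) * (\<Sum>j<d. (sqrt (- Im (z j)))\<^sup>2)"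
    by (rule Cauchy_Schwarz_ineq_sum)
  moreover have "(\<Sum>j<d. (sqrt (- Im (z j)) / norm (z j))\<^sup>2) = (\<Sum>j<d. - Im (z j) / (norm (z j))\<^sup>2)"
    using assms by (intro sum.cong) (auto simp: power_divide less_imp_le)
  moreover have "(\<Sum>j<d. (sqrt (- Im (z j)))\<^sup>2) = (\<Sum>j<d. - Im (z j))"
    using assms by (intro sum.cong) (auto simp: less_imp_le)
  ultimately have "(Im ?P)\<^sup>2 \<le> (norm ?P)\<^sup>2 * ?S\<^sup>2"
     and "?S\<^sup>2 \<le> (\<Sum>j<d. - Im (z j) / (norm (z j))\<^sup>2) * (\<Sum>j<d. - Im (z j))"
    by simp_all
  then show ?thesis
    by (meson mult_left_mono order_trans zero_le_power2)
qed

lemma norm_vector_scalar_mult: "norm (c *s v) = norm c * norm (v :: complex ^ 'n::finite)"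
  by (simp add: norm_vec_def norm_mult L2_set_right_distrib)

lemma continuous_on_vector_scalar_mult [continuous_intros]:
  fixes f :: "'b::topological_space \<Rightarrow> complex" and g :: "'b \<Rightarrow> complex ^ 'n::finite"
  assumes "continuous_on S f" "continuous_on S g"
  shows "continuous_on S (\<lambda>x. f x *s g x)"
  unfolding vector_scalar_mult_def
  by (intro continuous_on_vec_lambda continuous_on_mult continuous_on_component assms)

lemma hyperbolic_real_roots:
  assumes "hyperbolic h e" and "ceval h (z *s cvec e - cvec a) = 0"
  shows "z \<in> \<real>"
  using assms unfolding hyperbolic_def poly_complexified_line_poly by metis

text \<open>A zero would make the non-real number \<open>\<i> * \<alpha>\<close> a root of h(te -
  (-y)).\<close>

lemma hyperbolic_nonzero_imaginary_shift:
  assumes "hyperbolic h e" and "\<alpha> \<noteq> 0"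
  shows "ceval h (cvec y + (\<i> * of_real \<alpha>) *s cvec e) \<noteq> 0"
proof
  assume "ceval h (cvec y + (\<i> * of_real \<alpha>) *s cvec e) = 0"
  moreover have "(\<i> * of_real \<alpha>) *s cvec e - cvec (- y) = cvec y + (\<i> * of_real \<alpha>) *s cvec e"
    by (simp add: vec_eq_iff)
  ultimately have "ceval h ((\<i> * of_real \<alpha>) *s cvec e - cvec (- y)) = 0"
    by metis
  with assms(1) have "\<i> * of_real \<alpha> \<in> \<real>"
    by (rule hyperbolic_real_roots)
  then show False
    using assms(2) by (simp add: complex_is_Real_iff)
qed

text \<open>Dividing by \<open>- s\<close> turns the zero into a root
  \<open>t = - \<i> \<alpha> / s\<close> of h(te - a). Hyperbolicity makes it real and the cone
  makes it nonnegative, so \<open>t * Im s = - \<alpha> < 0\<close> forces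
  \<open>Im s < 0\<close>.\<close>

lemma hyperbolic_cone_roots_lower_base:
  fixes h :: "('n::finite) real_mpoly"
  assumes hyp: "hyperbolic h e" and cone: "a \<in> hyperbolicity_cone h e"
    and "\<alpha> > 0" and zero: "ceval h ((\<i> * of_real \<alpha>) *s cvec e + s *s cvec a) = 0"
  shows "Im s < 0"
proof (cases "s = 0")
  case True
  have "ceval h (cvec 0 + (\<i> * of_real \<alpha>) *s cvec e) \<noteq> 0"
    using hyperbolic_nonzero_imaginary_shift[OF hyp, of \<alpha> 0] \<open>\<alpha> > 0\<close> by simp
  moreover have "cvec (0 :: real ^ 'n) = 0" by (simp add: vec_eq_iff)
  moreover have "(\<i> * of_real \<alpha>) *s cvec e + s *s cvec a = 0 + (\<i> * of_real \<alpha>) *s cvec e"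
    by (simp add: True)
  ultimately show ?thesis using zero by metis
next
  case False
  obtain d where d: "\<And>m. m \<in> Poly_Mapping.keys h \<Longrightarrow> (\<Sum>i\<in>UNIV. Poly_Mapping.lookup m i) = d"
    using hyperbolic_degree[OF hyp] by auto
  define t where "t = - (\<i> * of_real \<alpha>) / s"
  have "(\<i> * of_real \<alpha>) *s cvec e + s *s cvec a = (- s) *s (t *s cvec e - cvec a)"
    using False by (simp add: vec_eq_iff t_def algebra_simps)
  then have "(- s) ^ d * ceval h (t *s cvec e - cvec a) = 0"
    using zero by (simp only: ceval_scale[OF d])
  then have t0: "ceval h (t *s cvec e - cvec a) = 0"
    using False by simp
  with hyp have "t \<in> \<real>"
    by (rule hyperbolic_real_roots)
  then obtain r where r: "t = of_real r"
    by (rule Reals_cases)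
  have "poly (line_poly h e a) r = 0"
    using t0 by (simp add: r poly_map_poly_of_real flip: poly_complexified_line_poly)
  then have "r \<ge> 0"
    using cone unfolding hyperbolicity_cone_def by blast
  have rs: "of_real r * s = - (\<i> * of_real \<alpha>)"
    using False unfolding r[symmetric] t_def by simp
  then have "r * Im s = - \<alpha>" "r * Re s = 0"
    by (simp_all add: complex_eq_iff)
  then show ?thesis
    using \<open>r \<ge> 0\<close> \<open>\<alpha> > 0\<close> by (metis mult_nonneg_nonneg neg_0_le_iff_le not_less)
qed

text \<open>
  Moving \<open>x\<close> to \<open>0\<close> along a segment, no zero crosses the real axis, so the zeros stay on the side
  where they are for \<open>x = 0\<close>. The parameters with a zero in the closed upper half plane form a
  closed set \<open>A\<close>; off \<open>A\<close>, the factorization bounds \<open>\<bar>F l s\<bar>\<close> below by a positive quantity that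
  does not depend on \<open>l\<close>, which makes the complement closed as well.
\<close>

lemma hyperbolic_cone_roots_lower:
  assumes hyp: "hyperbolic h e" and cone: "a \<in> hyperbolicity_cone h e" and nz: "meval h a \<noteq> 0"
    and "\<alpha> > 0"
    and zero: "ceval h (cvec x + (\<i> * of_real \<alpha>) *s cvec e + s *s cvec a) = 0"
  shows "Im s < 0"
proof (rule ccontr)
  assume "\<not> Im s < 0"
  obtain d where d: "\<And>m. m \<in> Poly_Mapping.keys h \<Longrightarrow> (\<Sum>i\<in>UNIV. Poly_Mapping.lookup m i) = d"
    using hyperbolic_degree[OF hyp] by auto
  define U where "U l = complex_of_real l *s cvec x + (\<i> * of_real \<alpha>) *s cvec e" for l
  define F where "F l s = ceval h (U l + s *s cvec a)" for l s
  have nz': "ceval h (cvec a) \<noteq> 0"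
    using nz by (simp add: ceval_cvec)
  have contU: "continuous_on S (\<lambda>x. U (f x))" if "continuous_on S f"
    for S :: "'c::topological_space set" and f
    unfolding U_def by (intro continuous_intros that)
  have contF: "continuous_on S (\<lambda>x. F (f x) (g x))" if "continuous_on S f" "continuous_on S g"
    for S :: "'c::topological_space set" and f g
    unfolding F_def by (intro continuous_intros contU that)
  \<comment> \<open>For real \<open>s\<close> the vector \<open>s a\<close> joins the real base
    point, and only the imaginary shift along \<open>e\<close> remains.\<close>
  have real_nz: "F l s \<noteq> 0" if "Im s = 0" for l s
  proof -
    have "U l + s *s cvec a = cvec (l *\<^sub>R x + Re s *\<^sub>R a) + (\<i> * of_real \<alpha>) *s cvec e"
      using that by (simp add: vec_eq_iff U_def complex_eq_iff)
    then show ?thesis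
      using hyperbolic_nonzero_imaginary_shift[OF hyp, of \<alpha>] \<open>\<alpha> > 0\<close> by (simp add: F_def)
  qed
  define A where "A = {l \<in> {0..1}. \<exists>s. Im s \<ge> 0 \<and> F l s = 0}"
  define B where "B = {l \<in> {0..1}. \<forall>s. Im s \<ge> 0 \<longrightarrow> norm (ceval h (cvec a)) * Im s ^ d \<le> norm (F l s)}"
  have B: "l \<in> B" if "l \<in> {0..1}" "l \<notin> A" for l
  proof -
    obtain z where z: "\<And>s. F l s = ceval h (cvec a) * (\<Prod>j<d. s - z j)"
      using ceval_line_factor[OF d nz', of "U l"] unfolding F_def by metis
    have "norm (ceval h (cvec a)) * Im s ^ d \<le> norm (F l s)" if s: "Im s \<ge> 0" for s
    proof -
      have "Im (z j) < 0" if "j < d" for j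
      proof -
        have "F l (z j) = 0" using z[of "z j"] that by auto
        moreover have "\<not> (\<exists>s. 0 \<le> Im s \<and> F l s = 0)"
          using \<open>l \<in> {0..1}\<close> \<open>l \<notin> A\<close> unfolding A_def by blast
        ultimately show ?thesis
          by (meson linorder_not_le)
      qed
      \<comment> \<open>Since \<open>z j\<close> lies below the real axis, \<open>Im s\<close> is at
        most \<open>Im (s - z j)\<close>.\<close>
      then have "Im s \<le> norm (s - z j)" if "j < d" for j
        using that abs_Im_le_cmod[of "s - z j"] by fastforce
      then have "(\<Prod>j<d. Im s) \<le> (\<Prod>j<d. norm (s - z j))"
        using s by (intro prod_mono) auto
      then show ?thesis
        by (simp add: z norm_mult prod_norm mult_left_mono)
    qed
    then show ?thesis using that by (simp add: B_def)
  qed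
  have "closed B"
  proof -
    have "B = {0..1} \<inter> (\<Inter>s\<in>{s. Im s \<ge> 0}. {l. norm (ceval h (cvec a)) * Im s ^ d \<le> norm (F l s)})"
      by (auto simp: B_def)
    also have "closed \<dots>"
      by (intro closed_Int closed_INT ballI closed_atLeastAtMost closed_Collect_le continuous_intros contF)
    finally show ?thesis .
  qed
  have "closed A"
  proof -
    \<comment> \<open>The zeros stay in a fixed disc, so \<open>A\<close> is the projection of a
      compact set. Indeed, if \<open>F l s = 0\<close> with |s| > M / \<delta>, dividing by
      \<open>s\<close> produces a zero of h within \<delta> of \<open>a\<close>, where h does not
      vanish.\<close>
    obtain \<delta> where \<delta>: "\<delta> > 0" "\<And>v. dist v (cvec a) < \<delta> \<Longrightarrow> ceval h v \<noteq> 0"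
    proof -
      have "open {v. ceval h v \<noteq> 0}"
        by (intro open_Collect_neq continuous_intros)
      then show thesis
        using nz' that unfolding open_dist by blast
    qed
    define M where "M = norm (cvec x) + norm ((\<i> * of_real \<alpha>) *s cvec e)"
    have M: "norm (U l) \<le> M" if "l \<in> {0..1}" for l
    proof -
      have "norm (complex_of_real l *s cvec x) \<le> 1 * norm (cvec x)"
        unfolding norm_vector_scalar_mult using that by (intro mult_right_mono) auto
      then show ?thesis
        unfolding U_def M_def by norm
    qed
    have bound: "norm s \<le> M / \<delta>" if "l \<in> {0..1}" "F l s = 0" for l s
    proof (rule ccontr)
      assume "\<not> norm s \<le> M / \<delta>"
      then have s: "M < norm s * \<delta>" using \<delta> by (simp add: field_simps)
      have "M \<ge> 0" by (simp add: M_def)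
      with s have "s \<noteq> 0" by auto
      have "U l + s *s cvec a = s *s (cvec a + (1 / s) *s U l)"
        using \<open>s \<noteq> 0\<close> by (simp add: vec_eq_iff field_simps)
      then have "s ^ d * ceval h (cvec a + (1 / s) *s U l) = 0"
        using that(2) by (simp only: F_def ceval_scale[OF d])
      then have "ceval h (cvec a + (1 / s) *s U l) = 0"
        using \<open>s \<noteq> 0\<close> by simp
      moreover have "norm ((1 / s) *s U l) < \<delta>"
        unfolding norm_vector_scalar_mult using M[OF that(1)] s \<open>s \<noteq> 0\<close>
        by (simp add: norm_divide field_simps)
      ultimately show False
        using \<delta>(2)[of "cvec a + (1 / s) *s U l"] by (simp add: dist_norm)
    qed
    define C where "C = ({0..1} \<times> cball 0 (M / \<delta>)) \<inter> {p. Im (snd p) \<ge> 0 \<and> F (fst p) (snd p) = 0}"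
    have "compact C"
      unfolding C_def
      by (intro compact_Int_closed compact_Times compact_Icc compact_cball closed_Collect_conj
          closed_Collect_le closed_Collect_eq continuous_intros contF)
    then have "compact (fst ` C)"
      by (intro compact_continuous_image continuous_intros)
    moreover have "A = fst ` C"
      unfolding A_def C_def using bound by (force simp: image_iff)
    ultimately show ?thesis
      by (simp add: compact_imp_closed)
  qed
  have "A \<inter> B = {}"
  proof (rule ccontr)
    assume "A \<inter> B \<noteq> {}"
    then obtain l s where ls: "l \<in> B" "Im s \<ge> 0" "F l s = 0" by (auto simp: A_def)
    then have "Im s > 0" using real_nz[of s l] by fastforce
    have "norm (ceval h (cvec a)) * Im s ^ d \<le> norm (F l s)"
      using ls(1,2) unfolding B_def by blast
    then have "norm (ceval h (cvec a)) * Im s ^ d \<le> 0"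
      by (simp add: ls(3))
    moreover have "norm (ceval h (cvec a)) * Im s ^ d > 0"
      using \<open>Im s > 0\<close> nz' by simp
    ultimately show False by simp
  qed
  moreover have "{0..1} \<subseteq> A \<union> B"
    using B by blast
  \<comment> \<open>The interval is connected and covered by the disjoint closed sets
    \<open>A\<close> and \<open>B\<close>. The assumed zero puts 1 into \<open>A\<close>, while the
    case of base point 0 puts 0 into \<open>B\<close>: a contradiction.\<close>
  ultimately have "A \<inter> {0..1} = {} \<or> B \<inter> {0..1} = {}"
    using connected_closedD[of "{0..1::real}" A B] \<open>closed A\<close> \<open>closed B\<close> by auto
  moreover have "1 \<in> A"
    using zero \<open>\<not> Im s < 0\<close> by (auto simp: A_def F_def U_def intro!: exI[of _ s])
  moreover have "0 \<notin> A"
  proof -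
    have "U 0 = (\<i> * of_real \<alpha>) *s cvec e" by (simp add: U_def vec_eq_iff)
    then show ?thesis
      using hyperbolic_cone_roots_lower_base[OF hyp cone \<open>\<alpha> > 0\<close>]
      unfolding A_def F_def by fastforce
  qed
  ultimately show False
    using B[of 0] by auto
qed

section \<open>The Wronskian inequality\<close>

text \<open>The logarithmic derivative of the factorization at \<open>s = 0\<close> is the sum of 1
  / (-z_j), so -Im(D_a h(w) cnj(h(w))) equals |h(w)|^2 times the sum of -Im z_j / |z_j|^2. With the
  sum of -Im z_j evaluated as \<open>\<rho>\<close> times the quotient at \<open>a\<close>, the
  bound becomes \<open>lower_half_plane_prod_ineq\<close> scaled by
  \<open>c\<^sup>2\<close>.\<close>

lemma hyperbolic_shifted_ineq:
  assumes hyp: "hyperbolic h e" and cone: "a \<in> hyperbolicity_cone h e" and nz: "meval h a \<noteq> 0"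
    and "\<rho> > 0" and w_def: "w = cvec x + (\<i> * of_real \<rho>) *s cvec e"
  shows "(Im (ceval h w))\<^sup>2 \<le>
    - Im (ceval (dir_deriv a h) w * cnj (ceval h w)) * (\<rho> * (meval (dir_deriv e h) a / meval h a))"
    and "meval (dir_deriv e h) a / meval h a \<ge> 0"
proof -
  obtain d where d: "\<And>m. m \<in> Poly_Mapping.keys h \<Longrightarrow> (\<Sum>i\<in>UNIV. Poly_Mapping.lookup m i) = d"
    using hyperbolic_degree[OF hyp] by auto
  have nz': "ceval h (cvec a) \<noteq> 0"
    using nz by (simp add: ceval_cvec)
  obtain z where z: "\<And>s. ceval h (w + s *s cvec a) = ceval h (cvec a) * (\<Prod>j<d. s - z j)"
    using ceval_line_factor[OF d nz', of w] by metis
  have Imz: "Im (z j) < 0" if "j < d" for j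
    using hyperbolic_cone_roots_lower[OF hyp cone nz \<open>\<rho> > 0\<close>, of x "z j"] z[of "z j"] that
    by (auto simp: w_def)
  then have z0: "z j \<noteq> 0" if "j < d" for j
    using that by fastforce
  define c where "c = meval h a"
  define P where "P = (\<Prod>j<d. - z j)"
  have Hw: "ceval h w = of_real c * P"
    using z[of 0] by (simp add: P_def c_def ceval_cvec)
  have Gw: "ceval (dir_deriv a h) w = of_real c * (P * (\<Sum>j<d. 1 / (- z j)))"
  proof -
    have "((\<lambda>s. \<Prod>j<d. s - z j) has_field_derivative
        (\<Prod>j<d. 0 - z j) * (\<Sum>j<d. 1 / (0 - z j))) (at 0)"
      by (rule has_field_derivative_prod') (auto intro!: derivative_eq_intros simp: z0)
    then have "((\<lambda>s. ceval h (w + s *s cvec a)) has_field_derivative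
        of_real c * (P * (\<Sum>j<d. 1 / (- z j)))) (at 0)"
      unfolding z by (auto intro!: derivative_eq_intros simp: P_def c_def ceval_cvec)
    moreover have "((\<lambda>s. ceval h (w + s *s cvec a)) has_field_derivative
        ceval (dir_deriv a h) w) (at 0)"
      using DERIV_ceval_dir[of h w a 0] by simp
    ultimately show ?thesis
      by (rule DERIV_unique[rotated])
  qed
  have sum_z: "(\<Sum>j<d. - Im (z j)) = \<rho> * (meval (dir_deriv e h) a / c)"
  proof -
    \<comment> \<open>Homogeneity reverses the polynomial: the line through \<open>a\<close> in
      direction \<open>w\<close> has linear coefficient \<open>c\<close> times the sum of -z_j. The
      point \<open>t = 0\<close> is included because the derivative is taken there.\<close>
    have "ceval h (cvec a + t *s w) = of_real c * (\<Prod>j<d. 1 - t * z j)" for t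
    proof (cases "t = 0")
      case False
      have "cvec a + t *s w = t *s (w + (1 / t) *s cvec a)"
        using False by (simp add: vec_eq_iff field_simps)
      then have "ceval h (cvec a + t *s w) = of_real c * ((\<Prod>j<d. t) * (\<Prod>j<d. 1 / t - z j))"
        by (simp only: ceval_scale[OF d] z) (simp add: c_def ceval_cvec)
      also have "(\<Prod>j<d. t) * (\<Prod>j<d. 1 / t - z j) = (\<Prod>j<d. 1 - t * z j)"
        unfolding prod.distrib[symmetric] using False by (intro prod.cong) (auto simp: field_simps)
      finally show ?thesis .
    qed (simp add: c_def ceval_cvec)
    moreover have "((\<lambda>t. of_real c * (\<Prod>j<d. 1 - t * z j)) has_field_derivative
        of_real c * ((\<Prod>j<d. 1 - 0 * z j) * (\<Sum>j<d. - z j / (1 - 0 * z j)))) (at 0)"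
      by (intro DERIV_cmult has_field_derivative_prod') (auto intro!: derivative_eq_intros)
    ultimately have "((\<lambda>t. ceval h (cvec a + t *s w)) has_field_derivative
        of_real c * (\<Sum>j<d. - z j)) (at 0)"
      by simp
    moreover have "((\<lambda>t. ceval h (cvec a + t *s w)) has_field_derivative
        (\<Sum>i\<in>UNIV. w $ i * ceval (mpartial i h) (cvec a))) (at 0)"
      using DERIV_ceval_line[of h "cvec a" w 0] by simp
    ultimately have "of_real c * (\<Sum>j<d. - z j) = (\<Sum>i\<in>UNIV. w $ i * ceval (mpartial i h) (cvec a))"
      by (rule DERIV_unique)
    \<comment> \<open>Taking imaginary parts removes the contribution of \<open>x\<close> to
      \<open>w\<close> and leaves \<rho> times the derivative of h at \<open>a\<close> along
      \<open>e\<close>.\<close>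
    then have "Im (of_real c * (\<Sum>j<d. - z j)) = Im (\<Sum>i\<in>UNIV. w $ i * ceval (mpartial i h) (cvec a))"
      by simp
    then have "c * (\<Sum>j<d. - Im (z j)) = (\<Sum>i\<in>UNIV. \<rho> * (e $ i * meval (mpartial i h) a))"
      by (simp add: w_def ceval_cvec mult_ac)
    also have "\<dots> = \<rho> * meval (dir_deriv e h) a"
      by (simp add: meval_dir_deriv sum_distrib_left)
    finally show ?thesis
      using nz by (simp add: c_def field_simps)
  qed
  have "ceval (dir_deriv a h) w * cnj (ceval h w) = of_real (c\<^sup>2) * (P * cnj P) * (\<Sum>j<d. 1 / (- z j))"
    by (simp add: Hw Gw power2_eq_square mult_ac)
  also have "\<dots> = of_real ((c * norm P)\<^sup>2) * (\<Sum>j<d. 1 / (- z j))"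
    by (simp only: complex_norm_square[symmetric] of_real_mult power_mult_distrib)
  finally have eq: "Im (ceval (dir_deriv a h) w * cnj (ceval h w)) = (c * norm P)\<^sup>2 * Im (\<Sum>j<d. 1 / (- z j))"
    by (simp only: times_complex.sel Re_complex_of_real Im_complex_of_real mult_zero_left add_0_right)
  have "Im (\<Sum>j<d. 1 / (- z j)) = (\<Sum>j<d. Im (z j) / (norm (z j))\<^sup>2)"
    unfolding Im_sum by (intro sum.cong refl) (simp add: Im_divide cmod_power2)
  then have "- Im (ceval (dir_deriv a h) w * cnj (ceval h w)) =
      c\<^sup>2 * ((norm P)\<^sup>2 * (\<Sum>j<d. - Im (z j) / (norm (z j))\<^sup>2))"
    by (simp only: eq) (simp add: power_mult_distrib sum_negf)
  moreover have P_ineq: "(Im P)\<^sup>2 \<le> (norm P)\<^sup>2 *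
      ((\<Sum>j<d. - Im (z j) / (norm (z j))\<^sup>2) * (\<Sum>j<d. - Im (z j)))"
    unfolding P_def using Imz by (rule lower_half_plane_prod_ineq)
  moreover have "(Im (ceval h w))\<^sup>2 = c\<^sup>2 * (Im P)\<^sup>2"
    by (simp add: Hw power_mult_distrib)
  ultimately show "(Im (ceval h w))\<^sup>2 \<le>
    - Im (ceval (dir_deriv a h) w * cnj (ceval h w)) * (\<rho> * (meval (dir_deriv e h) a / meval h a))"
    using mult_left_mono[OF P_ineq zero_le_power2[of c]] sum_z
    by (simp add: c_def mult_ac)
  have "(\<Sum>j<d. - Im (z j)) \<ge> 0"
    using Imz by (intro sum_nonneg) (auto simp: less_imp_le)
  then show "meval (dir_deriv e h) a / meval h a \<ge> 0"
    unfolding sum_z c_def using \<open>\<rho> > 0\<close> by (rule mult_left_le_imp_le[of \<rho> 0, simplified])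
qed

section \<open>The limit of the shifted inequality as \<rho> tends to 0\<close>

lemma tendsto_imaginary_shift:
  fixes x e :: "real ^ 'n::finite"
  assumes w_def: "w = (\<lambda>\<rho>::real. cvec x + (\<i> * of_real \<rho>) *s cvec e)"
  shows "((\<lambda>\<rho>. Im (ceval p (w \<rho>)) / \<rho>) \<longlongrightarrow> meval (dir_deriv e p) x) (at_right 0)"
    and "((\<lambda>\<rho>. Re (ceval p (w \<rho>))) \<longlongrightarrow> meval p x) (at_right 0)"
proof -
  have "((\<lambda>s. ceval p (cvec x + s *s cvec e)) has_field_derivative
      ceval (dir_deriv e p) (cvec x)) (at (\<i> * of_real 0))"
    using DERIV_ceval_dir[of p "cvec x" e 0] by simp
  then have "((\<lambda>\<rho>. ceval p (w \<rho>)) has_vector_derivative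
      \<i> * meval (dir_deriv e p) x) (at 0)"
    unfolding w_def ceval_cvec
    by (auto intro!: derivative_eq_intros field_vector_diff_chain_at[where g="\<lambda>s. ceval p (cvec x + s *s cvec e)", unfolded o_def])
  then have "((\<lambda>\<rho>. Im (ceval p (w \<rho>))) has_vector_derivative
      Im (\<i> * meval (dir_deriv e p) x)) (at 0)"
    by (rule bounded_linear.has_vector_derivative[OF bounded_linear_Im])
  then have "((\<lambda>\<rho>. Im (ceval p (w \<rho>))) has_real_derivative meval (dir_deriv e p) x) (at 0)"
    by (simp add: has_real_derivative_iff_has_vector_derivative)
  \<comment> \<open>At \<rho> = 0 the value is real, so this quotient is the difference
    quotient.\<close>
  then have "((\<lambda>\<rho>. Im (ceval p (w \<rho>)) / \<rho>) \<longlongrightarrow> meval (dir_deriv e p) x) (at 0)"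
    by (simp add: has_field_derivative_iff w_def ceval_cvec)
  then show "((\<lambda>\<rho>. Im (ceval p (w \<rho>)) / \<rho>) \<longlongrightarrow> meval (dir_deriv e p) x) (at_right 0)"
    by (rule tendsto_mono[rotated]) (simp add: at_le)
  have "continuous_on UNIV (\<lambda>\<rho>. Re (ceval p (w \<rho>)))"
    unfolding w_def by (intro continuous_intros)
  then have "((\<lambda>\<rho>. Re (ceval p (w \<rho>))) \<longlongrightarrow> Re (ceval p (w 0))) (at 0)"
    by (simp add: continuous_on_def)
  then show "((\<lambda>\<rho>. Re (ceval p (w \<rho>))) \<longlongrightarrow> meval p x) (at_right 0)"
    by (auto simp: w_def ceval_cvec intro: tendsto_mono[rotated] at_le)
qed

text \<open>With H and G the values of h and D_a h at \<open>w \<rho>\<close>, -Im(G cnj H) = Re G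
  Im H - Re H Im G. Divided by \<rho> this tends to the Wronskian, and Im H / \<rho> tends to D_e
  h(x).\<close>

lemma wronskian_ineq_interior:
  assumes hyp: "hyperbolic h e" and cone: "a \<in> hyperbolicity_cone h e" and nz: "meval h a \<noteq> 0"
  shows "(meval (dir_deriv e h) x)\<^sup>2 \<le>
    meval (wronskian e a h) x * (meval (dir_deriv e h) a / meval h a)"
proof -
  define w where "w = (\<lambda>\<rho>::real. cvec x + (\<i> * of_real \<rho>) *s cvec e)"
  define K where "K = meval (dir_deriv e h) a / meval h a"
  let ?H = "\<lambda>\<rho>. ceval h (w \<rho>)" and ?G = "\<lambda>\<rho>. ceval (dir_deriv a h) (w \<rho>)"
  note lims = tendsto_imaginary_shift[OF w_def]
  have "((\<lambda>\<rho>. (Im (?H \<rho>) / \<rho>)\<^sup>2) \<longlongrightarrow> (meval (dir_deriv e h) x)\<^sup>2) (at_right 0)"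
    by (intro tendsto_intros lims)
  moreover have "((\<lambda>\<rho>. (Re (?G \<rho>) * (Im (?H \<rho>) / \<rho>) - Re (?H \<rho>) * (Im (?G \<rho>) / \<rho>)) * K) \<longlongrightarrow>
      (meval (dir_deriv a h) x * meval (dir_deriv e h) x -
       meval h x * meval (dir_deriv e (dir_deriv a h)) x) * K) (at_right 0)"
    by (intro tendsto_intros lims)
  moreover have "(Im (?H \<rho>) / \<rho>)\<^sup>2 \<le>
      (Re (?G \<rho>) * (Im (?H \<rho>) / \<rho>) - Re (?H \<rho>) * (Im (?G \<rho>) / \<rho>)) * K" if "\<rho> > 0" for \<rho>
  proof -
    have "(Im (?H \<rho>))\<^sup>2 \<le> - Im (?G \<rho> * cnj (?H \<rho>)) * (\<rho> * K)"
      using hyperbolic_shifted_ineq(1)[OF hyp cone nz that refl, of x] by (simp add: w_def K_def)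
    then have "(Im (?H \<rho>))\<^sup>2 / \<rho>\<^sup>2 \<le> - Im (?G \<rho> * cnj (?H \<rho>)) * (\<rho> * K) / \<rho>\<^sup>2"
      by (intro divide_right_mono) auto
    then show ?thesis
      using that by (simp add: power_divide power2_eq_square field_simps)
  qed
  ultimately have "(meval (dir_deriv e h) x)\<^sup>2 \<le> (meval (dir_deriv a h) x * meval (dir_deriv e h) x -
       meval h x * meval (dir_deriv e (dir_deriv a h)) x) * K"
    by (elim tendsto_le[OF trivial_limit_at_right_real, rotated])
       (auto simp: eventually_at_filter)
  then show ?thesis
    by (simp add: wronskian_def meval_diff meval_mult K_def mult_ac)
qed

text \<open>The quotient in \<open>wronskian_ineq_interior\<close> is nonnegative by
  \<open>hyperbolic_shifted_ineq\<close> and nonzero by assumption, so multiplying by its reciprocal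
  keeps the inequality.\<close>

lemma wronskian_ge_interior:
  assumes hyp: "hyperbolic h e" and cone: "a \<in> hyperbolicity_cone h e" and nz: "meval h a \<noteq> 0"
    and nz': "meval (dir_deriv e h) a \<noteq> 0"
  shows "meval h a / meval (dir_deriv e h) a * (meval (dir_deriv e h) x)\<^sup>2 \<le> meval (wronskian e a h) x"
    and "meval h a / meval (dir_deriv e h) a > 0"
proof -
  have "meval (dir_deriv e h) a / meval h a \<ge> 0"
    using hyperbolic_shifted_ineq(2)[OF hyp cone nz zero_less_one refl] by simp
  then have K: "meval (dir_deriv e h) a / meval h a > 0"
    using nz nz' by (simp add: less_le)
  then show "meval h a / meval (dir_deriv e h) a > 0"
    by (simp add: zero_less_divide_iff conj_commute disj_commute)
  then show "meval h a / meval (dir_deriv e h) a * (meval (dir_deriv e h) x)\<^sup>2 \<le> meval (wronskian e a h) x"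
    using mult_left_mono[OF wronskian_ineq_interior[OF hyp cone nz, of x], of "meval h a / meval (dir_deriv e h) a"]
      nz nz' by simp
qed

section \<open>Perturbation of \<open>a\<close> along \<open>e\<close> and the boundary case\<close>

lemma hyperbolicity_cone_shift:
  assumes hyp: "hyperbolic h e" and cone: "a \<in> hyperbolicity_cone h e" and "\<epsilon> > 0"
  shows "a + \<epsilon> *\<^sub>R e \<in> hyperbolicity_cone h e" and "meval h (a + \<epsilon> *\<^sub>R e) \<noteq> 0"
proof -
  \<comment> \<open>Adding \<open>\<epsilon> e\<close> to \<open>a\<close> translates all roots by
    \<epsilon>.\<close>
  have pos: "t \<ge> \<epsilon>" if "poly (line_poly h e (a + \<epsilon> *\<^sub>R e)) t = 0" for t
  proof -
    have "t *\<^sub>R e - (a + \<epsilon> *\<^sub>R e) = (t - \<epsilon>) *\<^sub>R e - a"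
      by (simp add: algebra_simps)
    then have "poly (line_poly h e a) (t - \<epsilon>) = 0"
      using that unfolding poly_line_poly by metis
    then show ?thesis
      using cone by (auto simp: hyperbolicity_cone_def)
  qed
  then show "a + \<epsilon> *\<^sub>R e \<in> hyperbolicity_cone h e"
    using \<open>\<epsilon> > 0\<close> by (fastforce simp: hyperbolicity_cone_def)
  obtain d where d: "\<And>m. m \<in> Poly_Mapping.keys h \<Longrightarrow> (\<Sum>i\<in>UNIV. Poly_Mapping.lookup m i) = d"
    using hyperbolic_degree[OF hyp] by auto
  \<comment> \<open>All roots are at least \<epsilon>, so 0 is not a root; homogeneity then removes
    the sign.\<close>
  have "meval h (- (a + \<epsilon> *\<^sub>R e)) \<noteq> 0"
    using pos[of 0] \<open>\<epsilon> > 0\<close> by (auto simp: poly_line_poly)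
  moreover have "cvec (- (a + \<epsilon> *\<^sub>R e)) = (- 1) *s cvec (a + \<epsilon> *\<^sub>R e)"
    by (simp add: vec_eq_iff)
  then have "complex_of_real (meval h (- (a + \<epsilon> *\<^sub>R e))) = (- 1) ^ d * of_real (meval h (a + \<epsilon> *\<^sub>R e))"
    by (metis ceval_cvec ceval_scale[OF d])
  ultimately show "meval h (a + \<epsilon> *\<^sub>R e) \<noteq> 0"
    by auto
qed

lemma continuous_on_meval [continuous_intros]:
  "continuous_on S f \<Longrightarrow> continuous_on S (\<lambda>x. meval p (f x))"
  unfolding meval_def by (intro continuous_intros)

text \<open>Equal values along the line in direction \<open>e\<close> have equal derivatives, so
  linearity follows from uniqueness of the derivative instead of a comparison of
  coefficients.\<close>

lemma ceval_dir_deriv_lincomb: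
  assumes "\<And>v. ceval p v = ceval q v + c * ceval r v"
  shows "ceval (dir_deriv e p) v = ceval (dir_deriv e q) v + c * ceval (dir_deriv e r) v"
proof -
  note D = DERIV_ceval_dir[of _ v e 0, simplified]
  have "((\<lambda>s. ceval q (v + s *s cvec e) + c * ceval r (v + s *s cvec e)) has_field_derivative
      ceval (dir_deriv e q) v + c * ceval (dir_deriv e r) v) (at 0)"
    by (intro DERIV_add DERIV_cmult D)
  then show ?thesis
    using DERIV_unique[OF D[of p]] assms by simp
qed

lemma meval_wronskian_add:
  "meval (wronskian e (a + \<epsilon> *\<^sub>R b) h) x =
     meval (wronskian e a h) x + \<epsilon> * meval (wronskian e b h) x"
proof -
  have D: "ceval (dir_deriv (a + \<epsilon> *\<^sub>R b) h) v =
      ceval (dir_deriv a h) v + of_real \<epsilon> * ceval (dir_deriv b h) v" for v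
    by (simp add: ceval_dir_deriv sum.distrib sum_distrib_left algebra_simps)
  note ceval_dir_deriv_lincomb[OF D, of e "cvec x"] D[of "cvec x"]
  then have "complex_of_real (meval (wronskian e (a + \<epsilon> *\<^sub>R b) h) x) =
      of_real (meval (wronskian e a h) x + \<epsilon> * meval (wronskian e b h) x)"
    by (simp add: wronskian_def ceval_diff ceval_mult algebra_simps flip: ceval_cvec)
  then show ?thesis
    by (simp only: of_real_eq_iff)
qed

lemma wronskian_nonneg:
  assumes hyp: "hyperbolic h e" and cone: "a \<in> hyperbolicity_cone h e"
    and nz: "meval (dir_deriv e h) a \<noteq> 0"
  shows "0 \<le> meval (wronskian e a h) x"
proof -
  define b where "b \<epsilon> = a + \<epsilon> *\<^sub>R e" for \<epsilon> :: real
  have "continuous_on UNIV (\<lambda>\<epsilon>. meval (dir_deriv e h) (b \<epsilon>))"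
    unfolding b_def by (intro continuous_intros)
  then have "((\<lambda>\<epsilon>. meval (dir_deriv e h) (b \<epsilon>)) \<longlongrightarrow> meval (dir_deriv e h) (b 0)) (at 0)"
    by (simp add: continuous_on_def)
  \<comment> \<open>Continuity keeps D_e h nonzero near \<open>a\<close>, so the case of
    nonvanishing h applies to \<open>b \<epsilon>\<close> for small \<epsilon> > 0.\<close>
  then have "\<forall>\<^sub>F \<epsilon> in at 0. meval (dir_deriv e h) (b \<epsilon>) \<noteq> 0"
    by (rule tendsto_imp_eventually_ne) (simp add: b_def nz)
  then have "\<forall>\<^sub>F \<epsilon> in at_right 0. meval (dir_deriv e h) (b \<epsilon>) \<noteq> 0"
    by (simp add: eventually_at_split)
  then have "\<forall>\<^sub>F \<epsilon> in at_right 0. 0 \<le> meval (wronskian e (b \<epsilon>) h) x"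
    using eventually_at_right_less[of "0::real"]
  proof eventually_elim
    case (elim \<epsilon>)
    note b = hyperbolicity_cone_shift[OF hyp cone \<open>0 < \<epsilon>\<close>, folded b_def]
    \<comment> \<open>The lower bound has a positive coefficient, so it is dropped here and only
      nonnegativity passes to the limit.\<close>
    have "0 \<le> meval h (b \<epsilon>) / meval (dir_deriv e h) (b \<epsilon>) * (meval (dir_deriv e h) x)\<^sup>2"
      using wronskian_ge_interior(2)[OF hyp b elim(1)] by (intro mult_nonneg_nonneg) auto
    also have "\<dots> \<le> meval (wronskian e (b \<epsilon>) h) x"
      by (rule wronskian_ge_interior(1)[OF hyp b elim(1)])
    finally show ?case .
  qed
  moreover have "((\<lambda>\<epsilon>. meval (wronskian e (b \<epsilon>) h) x) \<longlongrightarrow> meval (wronskian e a h) x) (at_right 0)"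
  proof -
    have "((\<lambda>\<epsilon>. meval (wronskian e a h) x + \<epsilon> * meval (wronskian e e h) x) \<longlongrightarrow>
        meval (wronskian e a h) x + 0 * meval (wronskian e e h) x) (at_right 0)"
      by (intro tendsto_intros)
    then show ?thesis
      by (simp add: b_def meval_wronskian_add)
  qed
  ultimately show ?thesis
    by (intro tendsto_lowerbound) auto
qed

theorem mainTheorem6:
  fixes h :: "('n::finite) real_mpoly" and e a :: "real ^ 'n"
  assumes "hyperbolic h e"
    and "a \<in> hyperbolicity_cone h e"
    and "meval (dir_deriv e h) a \<noteq> 0"
  shows "\<forall>x. 0 \<le> meval (wronskian e a h -
           mconst (meval h a / meval (dir_deriv e h) a) * (dir_deriv e h)\<^sup>2) x"
proof
  fix x
  show "0 \<le> meval (wronskian e a h -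
           mconst (meval h a / meval (dir_deriv e h) a) * (dir_deriv e h)\<^sup>2) x"
  proof (cases "meval h a = 0")
    \<comment> \<open>The subtracted term vanishes, so nonnegativity of the Wronskian is the whole
      claim.\<close>
    case True
    then show ?thesis
      using wronskian_nonneg[OF assms] by (simp add: meval_diff meval_mult meval_mconst)
  next
    case False
    then show ?thesis
      using wronskian_ge_interior(1)[OF assms(1,2) False assms(3)]
      by (simp add: meval_diff meval_mult meval_mconst power2_eq_square)
  qed
qed

end
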